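(* There is an absolute constant $c>0$ such that for every $n\ge 1$ and $s\ge 1$ the following holds: if there is a monotone formula of size $s$ computing $\mathrm{MAJ}_{2n+1}$, then there is a formula of size at most $c\cdot s\cdot n^{\log_2 3}$ computing $\mathrm{MAJ}_{2n+1}$ and consisting only of $\mathrm{MAJ}_3$ gates and variables.
   Context: $\mathrm{MAJ}_{2n+1}\colon\{0,1\}^{2n+1}\to\{0,1\}$ outputs $1$ iff the input has at least $n+1$ ones; $\mathrm{MAJ}_3$ is the majority of three bits. A monotone formula is a rooted tree whose internal nodes are fan-in-2 $\wedge$ and $\vee$ gates and whose leaves are variables. A formula consisting only of $\mathrm{MAJ}_3$ gates and variables is a rooted tree whose internal nodes are $\mathrm{MAJ}_3$ gates with three children and whose leaves are variables (no constants, no negations). Size is the number of nodes. *)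

theory Defs
  imports Complex_Main
begin

(* Inputs from {0,1}^(2n+1) are functions x :: nat => bool, of which only the
   values x i with i < 2n+1 matter. *)

definition MAJ :: "nat \<Rightarrow> (nat \<Rightarrow> bool) \<Rightarrow> bool" where
  "MAJ n x \<longleftrightarrow> card {i. i < 2 * n + 1 \<and> x i} \<ge> n + 1"

definition maj3 :: "bool \<Rightarrow> bool \<Rightarrow> bool \<Rightarrow> bool" where
  "maj3 a b c \<longleftrightarrow> (a \<and> b) \<or> (a \<and> c) \<or> (b \<and> c)"

lemma maj3_eq_MAJ: "maj3 a b c \<longleftrightarrow> MAJ 1 (\<lambda>i. [a, b, c] ! i)"
proof -
  have "{i. i < 2 * 1 + 1 \<and> [a, b, c] ! i} =
      (if a then {0} else {}) \<union> (if b then {1} else {}) \<union> (if c then {2::nat} else {})"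
    (is "?L = ?R")
  proof (intro set_eqI)
    fix i :: nat
    consider "i = 0" | "i = 1" | "i = 2" | "i > 2" by linarith
    then show "i \<in> ?L \<longleftrightarrow> i \<in> ?R"
      by cases auto
  qed
  then show ?thesis
    unfolding MAJ_def maj3_def by simp
qed

datatype mon_formula =
    MVar nat
  | MAnd mon_formula mon_formula
  | MOr mon_formula mon_formula

fun mon_eval :: "mon_formula \<Rightarrow> (nat \<Rightarrow> bool) \<Rightarrow> bool" where
  "mon_eval (MVar i) x \<longleftrightarrow> x i"
| "mon_eval (MAnd f g) x \<longleftrightarrow> mon_eval f x \<and> mon_eval g x"
| "mon_eval (MOr f g) x \<longleftrightarrow> mon_eval f x \<or> mon_eval g x"

fun mon_vars :: "mon_formula \<Rightarrow> nat set" where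
  "mon_vars (MVar i) = {i}"
| "mon_vars (MAnd f g) = mon_vars f \<union> mon_vars g"
| "mon_vars (MOr f g) = mon_vars f \<union> mon_vars g"

(* Leaves count as nodes, unlike in the automatically generated size function. *)
fun mon_size :: "mon_formula \<Rightarrow> nat" where
  "mon_size (MVar i) = 1"
| "mon_size (MAnd f g) = 1 + mon_size f + mon_size g"
| "mon_size (MOr f g) = 1 + mon_size f + mon_size g"

datatype maj_formula =
    JVar nat
  | JMaj maj_formula maj_formula maj_formula

fun maj_eval :: "maj_formula \<Rightarrow> (nat \<Rightarrow> bool) \<Rightarrow> bool" where
  "maj_eval (JVar i) x \<longleftrightarrow> x i"
| "maj_eval (JMaj f g h) x \<longleftrightarrow> maj3 (maj_eval f x) (maj_eval g x) (maj_eval h x)"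

fun maj_vars :: "maj_formula \<Rightarrow> nat set" where
  "maj_vars (JVar i) = {i}"
| "maj_vars (JMaj f g h) = maj_vars f \<union> maj_vars g \<union> maj_vars h"

fun maj_size :: "maj_formula \<Rightarrow> nat" where
  "maj_size (JVar i) = 1"
| "maj_size (JMaj f g h) = 1 + maj_size f + maj_size g + maj_size h"

(* A formula for MAJ n may use only the 2n+1 input variables. *)

definition mon_computes_MAJ :: "mon_formula \<Rightarrow> nat \<Rightarrow> bool" where
  "mon_computes_MAJ f n \<longleftrightarrow>
     mon_vars f \<subseteq> {..<2 * n + 1} \<and> (\<forall>x. mon_eval f x = MAJ n x)"

definition maj_computes_MAJ :: "maj_formula \<Rightarrow> nat \<Rightarrow> bool" where
  "maj_computes_MAJ f n \<longleftrightarrow>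
     maj_vars f \<subseteq> {..<2 * n + 1} \<and> (\<forall>x. maj_eval f x = MAJ n x)"

end

theory Submission
  imports Defs
begin

text \<open>
  Replace every \<open>\<and>\<close> gate of the monotone formula by \<open>MAJ\<^sub>3(_, _, x\<^sub>i)\<close> and every \<open>\<or>\<close> gate by
  \<open>MAJ\<^sub>3(_, _, x\<^sub>j)\<close>. If \<open>x\<^sub>i \<noteq> x\<^sub>j\<close>, the result is the given function or its dual, and majority is
  self-dual; if \<open>x\<^sub>i = x\<^sub>j\<close> agrees with the majority of \<open>x\<close>, the result is still right by
  monotonicity. Hence for random \<open>i, j\<close> the error probability on a fixed input is at most \<open>1/4\<close>.
  A complete \<open>MAJ\<^sub>3\<close> tree of depth \<open>log\<^sub>2 n + O(1)\<close> over independent such formulas squares the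
  error (up to the factor 3) at each level, bringing it below \<open>2\<^bsup>-(2n+1)\<^esup>\<close>, so by the union bound
  some choice of the leaves is right on all inputs. The tree has \<open>O(n\<^bsup>log\<^sub>2 3\<^esup>)\<close> leaves.
\<close>

section \<open>Formulas of majority gates\<close>

lemma maj_eval_cong:
  assumes "\<And>i. i \<in> maj_vars t \<Longrightarrow> x i = y i"
  shows "maj_eval t x = maj_eval t y"
  using assms by (induction t) auto

text \<open>\<open>maj3\<close> commutes with negation. Taking the correct output as
  \<open>b\<close> turns a tree that is false on the pattern of leaf errors into one that answers
  correctly.\<close>

lemma maj_eval_self_dual: "maj_eval t (\<lambda>i. x i \<noteq> b) \<longleftrightarrow> maj_eval t x \<noteq> b"
  by (induction t) (auto simp: maj3_def)

fun maj_subst :: "(nat \<Rightarrow> maj_formula) \<Rightarrow> maj_formula \<Rightarrow> maj_formula" where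
  "maj_subst \<sigma> (JVar i) = \<sigma> i"
| "maj_subst \<sigma> (JMaj f g h) = JMaj (maj_subst \<sigma> f) (maj_subst \<sigma> g) (maj_subst \<sigma> h)"

lemma maj_eval_subst: "maj_eval (maj_subst \<sigma> t) x = maj_eval t (\<lambda>i. maj_eval (\<sigma> i) x)"
  by (induction t) auto

lemma maj_vars_subst: "maj_vars (maj_subst \<sigma> t) = (\<Union>i\<in>maj_vars t. maj_vars (\<sigma> i))"
  by (induction t) auto

section \<open>Amplification by random majority trees\<close>

text \<open>The sample space: a uniform element is a complete tree of depth \<open>k\<close> with
  independent uniform leaves, so probabilities become ratios of cardinalities.\<close>

fun complete_trees :: "nat \<Rightarrow> nat \<Rightarrow> maj_formula set" where
  "complete_trees N 0 = JVar ` {..<N}"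
| "complete_trees N (Suc k) =
     (\<lambda>(f, g, h). JMaj f g h) ` (complete_trees N k \<times> complete_trees N k \<times> complete_trees N k)"

lemma finite_complete_trees: "finite (complete_trees N k)"
  by (induction k) auto

lemma complete_trees_nonempty: "N > 0 \<Longrightarrow> complete_trees N k \<noteq> {}"
  by (induction k) auto

lemma maj_vars_complete_trees: "t \<in> complete_trees N k \<Longrightarrow> maj_vars t \<subseteq> {..<N}"
  by (induction k arbitrary: t) fastforce+

text \<open>Size plus one at most triples per level: the gate and the extra 1 are paid for by two of
  the three 1s of the subtrees.\<close>

lemma maj_size_subst_complete_trees:
  assumes "t \<in> complete_trees N k" and "\<And>i. maj_size (\<sigma> i) \<le> s"
  shows "maj_size (maj_subst \<sigma> t) + 1 \<le> 3 ^ k * (s + 1)"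
  using assms(1)
proof (induction k arbitrary: t)
  case 0
  then show ?case using assms(2) by auto
next
  case (Suc k)
  then obtain f g h where t: "t = JMaj f g h"
    and "f \<in> complete_trees N k" "g \<in> complete_trees N k" "h \<in> complete_trees N k"
    by auto
  then show ?case
    using Suc.IH[of f] Suc.IH[of g] Suc.IH[of h] by simp
qed

lemma inj_JMaj: "inj_on (\<lambda>(f, g, h). JMaj f g h) A"
  by (auto simp: inj_on_def)

lemma card_complete_trees_Suc: "card (complete_trees N (Suc k)) = card (complete_trees N k) ^ 3"
  by (simp add: card_image inj_JMaj card_cartesian_product power3_eq_cube)

definition true_trees :: "nat \<Rightarrow> nat \<Rightarrow> (nat \<Rightarrow> bool) \<Rightarrow> maj_formula set" where
  "true_trees N k y = {t \<in> complete_trees N k. maj_eval t y}"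

lemma card_true_trees_Suc:
  fixes N k :: nat and y :: "nat \<Rightarrow> bool"
  defines "b \<equiv> real (card (true_trees N k y))" and "c \<equiv> real (card (complete_trees N k))"
  shows "real (card (true_trees N (Suc k) y)) = 3 * b\<^sup>2 * c - 2 * b ^ 3"
proof -
  let ?J = "\<lambda>(f, g, h). JMaj f g h"
  let ?C = "complete_trees N k" and ?B = "true_trees N k y"
  let ?G = "?C - ?B"
  have fin: "finite ?C" "finite ?B"
    by (auto simp: true_trees_def finite_complete_trees)
  have sub: "?B \<subseteq> ?C" by (auto simp: true_trees_def)
  have G: "real (card ?G) = c - b"
    unfolding b_def c_def using sub fin by (simp add: card_Diff_subset card_mono of_nat_diff)
  have "true_trees N (Suc k) y = ?J ` {p \<in> ?C \<times> ?C \<times> ?C. maj_eval (?J p) y}"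
    unfolding true_trees_def complete_trees.simps by blast
  \<comment> \<open>Disjoint cases: the first two subtrees are true, or exactly one of them is and
    so is the third.\<close>
  also have "{p \<in> ?C \<times> ?C \<times> ?C. maj_eval (?J p) y} =
      (?B \<times> ?B \<times> ?C) \<union> (?B \<times> ?G \<times> ?B) \<union> (?G \<times> ?B \<times> ?B)"
    by (auto simp: true_trees_def maj3_def)
  finally have "card (true_trees N (Suc k) y) =
      card ((?B \<times> ?B \<times> ?C) \<union> (?B \<times> ?G \<times> ?B) \<union> (?G \<times> ?B \<times> ?B))"
    by (simp only: card_image[OF inj_JMaj])
  also have "\<dots> = card ((?B \<times> ?B \<times> ?C) \<union> (?B \<times> ?G \<times> ?B)) + card (?G \<times> ?B \<times> ?B)"
    by (rule card_Un_disjoint) (use fin in auto)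
  also have "card ((?B \<times> ?B \<times> ?C) \<union> (?B \<times> ?G \<times> ?B)) = card (?B \<times> ?B \<times> ?C) + card (?B \<times> ?G \<times> ?B)"
    by (rule card_Un_disjoint) (use fin in auto)
  finally have "real (card (true_trees N (Suc k) y)) = b * b * c + b * (c - b) * b + (c - b) * b * b"
    by (simp add: card_cartesian_product G flip: b_def c_def)
  then show ?thesis by (simp add: algebra_simps power2_eq_square power3_eq_cube)
qed

definition true_frac :: "nat \<Rightarrow> nat \<Rightarrow> (nat \<Rightarrow> bool) \<Rightarrow> real" where
  "true_frac N k y = card (true_trees N k y) / card (complete_trees N k)"

lemma true_frac_nonneg: "true_frac N k y \<ge> 0"
  by (simp add: true_frac_def)

lemma true_frac_Suc:
  assumes "N > 0"
  shows "true_frac N (Suc k) y = 3 * (true_frac N k y)\<^sup>2 - 2 * true_frac N k y ^ 3"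
proof -
  have "real (card (complete_trees N k)) \<noteq> 0"
    using complete_trees_nonempty[OF assms, of k] finite_complete_trees[of N k] by simp
  then show ?thesis
    unfolding true_frac_def card_true_trees_Suc card_complete_trees_Suc
    by (simp add: field_simps power2_eq_square power3_eq_cube)
qed

lemma true_frac_0: "true_frac N 0 y = card {i. i < N \<and> y i} / N"
proof -
  have "true_trees N 0 y = JVar ` {i. i < N \<and> y i}"
    by (auto simp: true_trees_def)
  then show ?thesis
    by (simp add: true_frac_def card_image inj_on_def)
qed

text \<open>For \<open>p\<close> the true fraction, \<open>3 * p\<close> is at most squared at each
  level. The first level is spent on getting from \<open>p \<le> 1/4\<close> to
  \<open>3 * p \<le> 15/32 < 1/2\<close>.\<close>

lemma true_frac_le:
  assumes "N > 0" and "4 * card {i. i < N \<and> y i} \<le> N"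
  shows "3 * true_frac N (Suc d) y \<le> (1/2) ^ (2 ^ d)"
proof (induction d)
  case 0
  define r where "r = true_frac N 0 y"
  have r: "0 \<le> r" "r \<le> 1/4"
    using assms by (simp_all add: r_def true_frac_0 field_simps)
  \<comment> \<open>Half of \<open>5/8 - (3 * r - 2 * r^2)\<close>, factored; 5/8 is the value of
    \<open>3 * r - 2 * r^2\<close> at \<open>r = 1/4\<close>.\<close>
  have "0 \<le> (1/4 - r) * (5/4 - r)" using r by (intro mult_nonneg_nonneg) auto
  moreover have "(1/4 - r) * (5/4 - r) = 5/16 - 3/2 * r + r\<^sup>2"
    by (simp add: field_simps power2_eq_square)
  ultimately have *: "3 * r - 2 * r\<^sup>2 \<le> 5/8" by linarith
  have "3 * r\<^sup>2 - 2 * r ^ 3 = r * (3 * r - 2 * r\<^sup>2)"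
    by (simp add: algebra_simps power2_eq_square power3_eq_cube)
  also have "\<dots> \<le> r * (5/8)" using r * by (intro mult_left_mono) auto
  finally show ?case using r by (simp add: true_frac_Suc[OF assms(1)] flip: r_def)
next
  case (Suc d)
  have "3 * true_frac N (Suc (Suc d)) y \<le> (3 * true_frac N (Suc d) y)\<^sup>2"
    unfolding true_frac_Suc[OF assms(1), of "Suc d"] power_mult_distrib
    using true_frac_nonneg[of N "Suc d" y] by simp
  also have "\<dots> \<le> ((1/2) ^ (2 ^ d))\<^sup>2"
    using Suc true_frac_nonneg[of N "Suc d" y] by (intro power_mono) auto
  finally show ?case by (simp add: power_mult[symmetric] mult.commute)
qed

text \<open>Union bound by counting: at most a third of all trees are true on some member of
  \<open>Y\<close>.\<close>

lemma ex_complete_tree_all_false: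
  assumes "N > 0" and "finite Y" and "card Y \<le> 2 ^ (2 ^ d)"
    and few: "\<And>y. y \<in> Y \<Longrightarrow> 4 * card {i. i < N \<and> y i} \<le> N"
  shows "\<exists>t \<in> complete_trees N (Suc d). \<forall>y \<in> Y. \<not> maj_eval t y"
proof (rule ccontr)
  let ?C = "complete_trees N (Suc d)"
  have C: "real (card ?C) > 0"
    using complete_trees_nonempty[OF \<open>N > 0\<close>, of "Suc d"] finite_complete_trees[of N "Suc d"]
    by (simp add: card_gt_0_iff del: complete_trees.simps)
  assume "\<not> ?thesis"
  then have "?C \<subseteq> (\<Union>y\<in>Y. true_trees N (Suc d) y)"
    by (auto simp: true_trees_def simp del: complete_trees.simps)
  moreover have "finite (\<Union>y\<in>Y. true_trees N (Suc d) y)"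
    using assms(2) finite_complete_trees[of N "Suc d"] by (simp add: true_trees_def)
  ultimately have "card ?C \<le> card (\<Union>y\<in>Y. true_trees N (Suc d) y)"
    by (rule card_mono[rotated])
  also have "\<dots> \<le> (\<Sum>y\<in>Y. card (true_trees N (Suc d) y))"
    by (rule card_UN_le[OF assms(2)])
  finally have "real (card ?C) \<le> (\<Sum>y\<in>Y. real (card (true_trees N (Suc d) y)))"
    by (metis of_nat_le_iff of_nat_sum)
  also have "\<dots> = (\<Sum>y\<in>Y. true_frac N (Suc d) y * card ?C)"
    using C by (simp add: true_frac_def del: complete_trees.simps)
  also have "\<dots> \<le> (\<Sum>y\<in>Y. (1/3) * (1/2) ^ (2 ^ d) * card ?C)"
  proof (intro sum_mono mult_right_mono)
    fix y assume "y \<in> Y"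
    then show "true_frac N (Suc d) y \<le> (1/3) * (1/2) ^ (2 ^ d)"
      using true_frac_le[OF assms(1) few, of y d] by linarith
  qed simp
  also have "\<dots> = real (card Y) * ((1/3) * (1/2) ^ (2 ^ d) * card ?C)"
    by simp
  also have "\<dots> \<le> 2 ^ (2 ^ d) * ((1/3) * (1/2) ^ (2 ^ d) * card ?C)"
    using of_nat_mono[OF assms(3), where 'a = real] by (intro mult_right_mono) auto
  also have "\<dots> = card ?C / 3"
    by (simp add: power_one_over del: complete_trees.simps)
  finally show False using C by simp
qed

section \<open>Simulating a monotone formula\<close>

fun simulate :: "nat \<Rightarrow> nat \<Rightarrow> mon_formula \<Rightarrow> maj_formula" where
  "simulate i j (MVar v) = JVar v"
| "simulate i j (MAnd f g) = JMaj (simulate i j f) (simulate i j g) (JVar i)"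
| "simulate i j (MOr f g) = JMaj (simulate i j f) (simulate i j g) (JVar j)"

lemma maj_size_simulate: "maj_size (simulate i j f) \<le> 2 * mon_size f"
  by (induction f) auto

lemma maj_vars_simulate: "maj_vars (simulate i j f) \<subseteq> mon_vars f \<union> {i, j}"
  by (induction f) auto

lemma simulate_eq:
  "\<not> x i \<Longrightarrow> x j \<Longrightarrow> maj_eval (simulate i j f) x = mon_eval f x"
  by (induction f) (auto simp: maj3_def)

text \<open>The control values are swapped, so conjunctions and disjunctions trade places; this is
  De Morgan.\<close>

lemma simulate_dual:
  "x i \<Longrightarrow> \<not> x j \<Longrightarrow> maj_eval (simulate i j f) x \<longleftrightarrow> \<not> mon_eval f (\<lambda>v. \<not> x v)"
  by (induction f) (auto simp: maj3_def)

text \<open>Here every gate acts as a disjunction, which can only raise values.\<close>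

lemma simulate_ge:
  "x i \<Longrightarrow> x j \<Longrightarrow> mon_eval f x \<Longrightarrow> maj_eval (simulate i j f) x"
  by (induction f) (auto simp: maj3_def)

lemma simulate_le:
  "\<not> x i \<Longrightarrow> \<not> x j \<Longrightarrow> maj_eval (simulate i j f) x \<Longrightarrow> mon_eval f x"
  by (induction f) (auto simp: maj3_def)

section \<open>Minority positions and the error of the simulation\<close>

lemma card_ones_plus_zeros:
  fixes m :: nat
  shows "card {i. i < m \<and> x i} + card {i. i < m \<and> \<not> x i} = m"
proof -
  have "card ({i. i < m \<and> x i} \<union> {i. i < m \<and> \<not> x i}) =
      card {i. i < m \<and> x i} + card {i. i < m \<and> \<not> x i}"
    by (rule card_Un_disjoint) auto
  moreover have "{i. i < m \<and> x i} \<union> {i. i < m \<and> \<not> x i} = {..<m}" by auto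
  ultimately show ?thesis by simp
qed

lemma MAJ_self_dual: "MAJ n (\<lambda>i. \<not> x i) \<longleftrightarrow> \<not> MAJ n x"
  using card_ones_plus_zeros[of "2 * n + 1" x] unfolding MAJ_def by linarith

lemma card_minority: "card {i. i < 2 * n + 1 \<and> x i \<noteq> MAJ n x} \<le> n"
proof (cases "MAJ n x")
  case True
  then show ?thesis using card_ones_plus_zeros[of "2 * n + 1" x] by (simp add: MAJ_def)
next
  case False
  then show ?thesis by (simp add: MAJ_def)
qed

text \<open>Differing controls never err, by self-duality of majority; equal controls err only when
  both oppose the majority.\<close>

lemma simulate_wrong:
  assumes "mon_computes_MAJ f n" and "maj_eval (simulate i j f) x \<noteq> MAJ n x"
  shows "x i \<noteq> MAJ n x" and "x j \<noteq> MAJ n x"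
proof -
  have f: "mon_eval f z = MAJ n z" for z
    using assms(1) by (simp add: mon_computes_MAJ_def)
  show "x i \<noteq> MAJ n x" "x j \<noteq> MAJ n x"
    using assms(2) simulate_eq[of x i j f] simulate_dual[of x i j f]
      simulate_ge[of x i j f] simulate_le[of x i j f]
    unfolding f MAJ_self_dual by blast+
qed

lemma card_div_mod_in_le:
  fixes K :: nat
  assumes "finite W"
  shows "card {m. m < K * K \<and> m div K \<in> W \<and> m mod K \<in> W} \<le> card W * card W"
proof -
  have "inj_on (\<lambda>m. (m div K, m mod K)) A" for A
    by (rule inj_onI) (metis div_mult_mod_eq prod.inject)
  then have "card {m. m < K * K \<and> m div K \<in> W \<and> m mod K \<in> W} \<le> card (W \<times> W)"
    by (rule card_inj_on_le) (use assms in auto)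
  then show ?thesis by (simp add: card_cartesian_product)
qed

text \<open>A leaf \<open>m < (2n+1)\<^sup>2\<close> of the tree encodes the pair \<open>(m div (2n+1), m mod (2n+1))\<close>.\<close>

lemma ex_maj_formula:
  assumes f: "mon_computes_MAJ f n" and d: "2 * n + 1 \<le> 2 ^ d"
  shows "\<exists>g. maj_computes_MAJ g n \<and> maj_size g + 1 \<le> 3 ^ Suc d * (2 * mon_size f + 1)"
proof -
  define K where "K = 2 * n + 1"
  define \<sigma> where "\<sigma> m = simulate (m div K) (m mod K) f" for m
  define wrong where "wrong x m \<longleftrightarrow> maj_eval (\<sigma> m) x \<noteq> MAJ n x" for x m
  \<comment> \<open>The error patterns. Restricting inputs to subsets of \<open>{..<K}\<close>
    leaves at most \<open>2 ^ K\<close> of them.\<close>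
  define Y where "Y = (\<lambda>S. wrong (\<lambda>i. i \<in> S)) ` Pow {..<K}"
  have K: "K > 0" by (simp add: K_def)
  have few: "4 * card {m. m < K * K \<and> wrong x m} \<le> K * K" for x
  proof -
    define W where "W = {i. i < K \<and> x i \<noteq> MAJ n x}"
    have finW: "finite W" by (simp add: W_def)
    have "{m. m < K * K \<and> wrong x m} \<subseteq> {m. m < K * K \<and> m div K \<in> W \<and> m mod K \<in> W}"
    proof safe
      fix m assume m: "m < K * K" and w: "wrong x m"
      note sim = simulate_wrong[OF f w[unfolded wrong_def \<sigma>_def]]
      show "m div K \<in> W"
        using sim(1) m by (simp add: W_def less_mult_imp_div_less)
      show "m mod K \<in> W"
        using sim(2) K by (simp add: W_def)
    qed
    then have "card {m. m < K * K \<and> wrong x m} \<le>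
        card {m. m < K * K \<and> m div K \<in> W \<and> m mod K \<in> W}"
      by (rule card_mono[rotated]) auto
    also have "\<dots> \<le> card W * card W"
      by (rule card_div_mod_in_le[OF finW])
    also have "\<dots> \<le> n * n"
      using card_minority[of n x] by (intro mult_le_mono) (simp_all add: W_def K_def)
    \<comment> \<open>\<open>4 * n * n \<le> (2 * n + 1)^2\<close>: the initial error is at most
      1/4.\<close>
    finally show ?thesis by (simp add: K_def algebra_simps)
  qed
  have "card Y \<le> 2 ^ K"
    unfolding Y_def using card_image_le[of "Pow {..<K}"] by (simp add: card_Pow)
  also have "\<dots> \<le> 2 ^ (2 ^ d)"
    using d by (intro power_increasing) (simp_all add: K_def)
  finally have "card Y \<le> 2 ^ (2 ^ d)" .
  moreover have "0 < K * K" "finite Y" using K by (simp_all add: Y_def)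
  moreover have "4 * card {m. m < K * K \<and> y m} \<le> K * K" if "y \<in> Y" for y
    using that few by (auto simp: Y_def)
  ultimately obtain t where
    t: "t \<in> complete_trees (K * K) (Suc d)" "\<forall>y \<in> Y. \<not> maj_eval t y"
    using ex_complete_tree_all_false[of "K * K" Y d] by blast
  let ?g = "maj_subst \<sigma> t"
  have vars: "maj_vars ?g \<subseteq> {..<K}"
  proof -
    have "mon_vars f \<subseteq> {..<K}"
      using f by (simp add: mon_computes_MAJ_def K_def)
    moreover have "m div K < K" "m mod K < K" if "m < K * K" for m
      using that K by (simp_all add: less_mult_imp_div_less)
    ultimately have "maj_vars (\<sigma> m) \<subseteq> {..<K}" if "m < K * K" for m
      using that maj_vars_simulate[of "m div K" "m mod K" f] unfolding \<sigma>_def by blast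
    then show ?thesis
      using maj_vars_complete_trees[OF t(1)] unfolding maj_vars_subst by blast
  qed
  have "maj_eval ?g x = MAJ n x" for x
  proof -
    \<comment> \<open>Clearing \<open>x\<close> outside \<open>{..<K}\<close> gives an input whose
      error pattern lies in \<open>Y\<close>, without changing either side.\<close>
    define S where "S = {i. i < K \<and> x i}"
    define z where "z = (\<lambda>i. i \<in> S)"
    have "wrong z \<in> Y" unfolding Y_def z_def by (rule imageI) (auto simp: S_def)
    then have "\<not> maj_eval t (\<lambda>m. maj_eval (\<sigma> m) z \<noteq> MAJ n z)"
      using t(2) by (simp add: wrong_def[abs_def])
    then have "maj_eval ?g z = MAJ n z"
      unfolding maj_eval_self_dual maj_eval_subst by simp
    moreover have "MAJ n z = MAJ n x"
      unfolding MAJ_def z_def S_def K_def by (simp add: conj_ac)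
    moreover have "maj_eval ?g z = maj_eval ?g x"
      by (rule maj_eval_cong) (use vars in \<open>auto simp: z_def S_def\<close>)
    ultimately show ?thesis by simp
  qed
  then have "maj_computes_MAJ ?g n"
    using vars by (simp add: maj_computes_MAJ_def K_def)
  moreover have "maj_size ?g + 1 \<le> 3 ^ Suc d * (2 * mon_size f + 1)"
    using t(1) by (rule maj_size_subst_complete_trees) (simp add: \<sigma>_def maj_size_simulate)
  ultimately show ?thesis by blast
qed

section \<open>From tree depth to the exponent \<open>log 2 3\<close>\<close>

lemma three_power_le_powr:
  assumes "2 ^ e \<le> (a::real)"
  shows "3 ^ e \<le> a powr log 2 3"
proof -
  have "(3::real) ^ e = (2 powr log 2 3) ^ e" by simp
  also have "\<dots> = (2 ^ e) powr log 2 3"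
    by (simp add: powr_powr mult.commute del: powr_log_cancel flip: powr_realpow)
  also have "\<dots> \<le> a powr log 2 3"
    using assms by (intro powr_mono2) auto
  finally show ?thesis .
qed

theorem theorem2:
  shows "\<exists>c::real. c > 0 \<and>
    (\<forall>(n::nat) (s::nat). n \<ge> 1 \<longrightarrow> s \<ge> 1 \<longrightarrow>
      (\<exists>f. mon_computes_MAJ f n \<and> mon_size f = s) \<longrightarrow>
      (\<exists>g. maj_computes_MAJ g n \<and>
           real (maj_size g) \<le> c * real s * real n powr log 2 3))"
proof (intro exI[of _ "27 * 3 powr log 2 3"] conjI allI impI)
  \<comment> \<open>The 27 is 9 for the two levels beyond \<open>e\<close>, times 3 from
    \<open>2 * s + 1 \<le> 3 * s\<close>; the factor \<open>3 powr log 2 3\<close> comes from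
    \<open>2 ^ e \<le> 3 * n\<close>.\<close>
  show "(0::real) < 27 * 3 powr log 2 3" by simp
next
  fix n s :: nat
  assume n: "n \<ge> 1" and s: "s \<ge> 1" and "\<exists>f. mon_computes_MAJ f n \<and> mon_size f = s"
  then obtain f where f: "mon_computes_MAJ f n" "mon_size f = s" by blast
  obtain e where e: "2 ^ e \<le> 2 * n + 1" "2 * n + 1 < 2 ^ (e + 1)"
    using ex_power_ivl1[of 2 "2 * n + 1"] by auto
  from e(2) have "2 * n + 1 \<le> 2 ^ Suc e" by simp
  from ex_maj_formula[OF f(1) this] obtain g where g: "maj_computes_MAJ g n"
    and size: "maj_size g + 1 \<le> 3 ^ Suc (Suc e) * (2 * s + 1)"
    using f(2) by blast
  have "2 ^ e \<le> 3 * n" using e(1) n by linarith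
  then have "2 ^ e \<le> real (3 * n)" by (metis of_nat_le_iff of_nat_numeral of_nat_power)
  then have "3 ^ e \<le> (3 * real n) powr log 2 3" using three_power_le_powr by simp
  then have e3: "3 ^ e \<le> 3 powr log 2 3 * real n powr log 2 3" by (simp add: powr_mult)
  have "maj_size g \<le> 3 ^ Suc (Suc e) * (3 * s)"
    using size s mult_le_mono2[of "2 * s + 1" "3 * s" "3 ^ Suc (Suc e)"] by linarith
  then have "real (maj_size g) \<le> real (3 ^ Suc (Suc e) * (3 * s))"
    by (rule of_nat_mono)
  also have "\<dots> = 27 * real s * 3 ^ e" by simp
  also have "\<dots> \<le> 27 * real s * (3 powr log 2 3 * real n powr log 2 3)"
    using e3 by (intro mult_left_mono) auto
  finally have "real (maj_size g) \<le> 27 * 3 powr log 2 3 * real s * real n powr log 2 3"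
    by (simp add: mult_ac)
  with g show "\<exists>g. maj_computes_MAJ g n \<and>
      real (maj_size g) \<le> 27 * 3 powr log 2 3 * real s * real n powr log 2 3"
    by blast
qed

end
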